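(* Let $n$ be a positive integer. If an abstract simplicial complex $\Delta\subseteq2^{[n]}$ is an initial segment complex, i.e. $\Delta=\Delta(\preceq,T)$ for some qualitative probability order $\preceq$ on $[n]$ and some $T\subseteq[n]$, then $\Delta$ satisfies $CC_k^*$ for all $k\le3$.
   Context: $[n]=\{1,\dots,n\}$. An order is a reflexive, complete and transitive binary relation. A qualitative probability order on $[n]$ is an order $\preceq$ on $2^{[n]}$ such that (1) $\emptyset\preceq A$ for every nonempty $A\subseteq[n]$, and (2) for all $A,B,C\subseteq[n]$ with $(A\cup B)\cap C=\emptyset$: $A\preceq B\iff A\cup C\preceq B\cup C$. $X\prec Y$ means $X\preceq Y$ but not $Y\preceq X$, and $\Delta(\preceq,T)=\{X\subseteq[n]\mid X\prec T\}$. A sequence $(A_1,\dots,A_k;B_1,\dots,B_k)$ of subsets of $[n]$ (repetitions allowed) is a trading transform of length $k$ if for every $i\in[n]$, $|\{j\mid i\in A_j\}|=|\{j\mid i\in B_j\}|$. A simplicial complex $\Delta\subseteq 2^{[n]}$ (a family closed under taking subsets) satisfies $CC_k^*$ ($k$ a positive integer) if there is no trading transform $(A_1,\dots,A_k;B_1,\dots,B_k)$ with $A_i\in\Delta$ and $B_i\notin\Delta$ for every $i\in[k]$. *)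

theory Defs
  imports Main
begin

text \<open>
  The relation \<open>X \<preceq> Y\<close> is modelled as \<open>(X, Y) \<in> r\<close> for a relation \<open>r\<close> on the power set of
  \<open>[n] = {1..n}\<close>. The library predicate \<open>total_on\<close> only speaks about distinct elements; together
  with the reflexivity in \<open>preorder_on\<close> this is completeness.
\<close>

definition qualitative_probability_order :: "nat \<Rightarrow> nat set rel \<Rightarrow> bool" where
  "qualitative_probability_order n r \<longleftrightarrow>
     preorder_on (Pow {1..n}) r \<and> total_on (Pow {1..n}) r \<and>
     (\<forall>A. A \<subseteq> {1..n} \<and> A \<noteq> {} \<longrightarrow> ({}, A) \<in> r) \<and>
     (\<forall>A B C. A \<subseteq> {1..n} \<and> B \<subseteq> {1..n} \<and> C \<subseteq> {1..n} \<and> (A \<union> B) \<inter> C = {} \<longrightarrow>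
        ((A, B) \<in> r \<longleftrightarrow> (A \<union> C, B \<union> C) \<in> r))"

definition strict_part :: "'a rel \<Rightarrow> 'a \<Rightarrow> 'a \<Rightarrow> bool" where
  "strict_part r X Y \<longleftrightarrow> (X, Y) \<in> r \<and> (Y, X) \<notin> r"

definition initial_segment :: "nat \<Rightarrow> nat set rel \<Rightarrow> nat set \<Rightarrow> nat set set" where
  "initial_segment n r T = {X. X \<subseteq> {1..n} \<and> strict_part r X T}"

text \<open>The void family \<open>{}\<close> is admitted as a simplicial complex.\<close>

definition simplicial_complex :: "nat \<Rightarrow> nat set set \<Rightarrow> bool" where
  "simplicial_complex n \<Delta> \<longleftrightarrow> \<Delta> \<subseteq> Pow {1..n} \<and> (\<forall>X\<in>\<Delta>. \<forall>Y. Y \<subseteq> X \<longrightarrow> Y \<in> \<Delta>)"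

definition initial_segment_complex :: "nat \<Rightarrow> nat set set \<Rightarrow> bool" where
  "initial_segment_complex n \<Delta> \<longleftrightarrow>
     simplicial_complex n \<Delta> \<and>
     (\<exists>r T. qualitative_probability_order n r \<and> T \<subseteq> {1..n} \<and> \<Delta> = initial_segment n r T)"

text \<open>
  A sequence \<open>(A\<^sub>1, \<dots>, A\<^sub>k)\<close> is a function on \<open>nat\<close> of which only the values at \<open>1, \<dots>, k\<close> matter.
\<close>

definition trading_transform ::
    "nat \<Rightarrow> nat \<Rightarrow> (nat \<Rightarrow> nat set) \<Rightarrow> (nat \<Rightarrow> nat set) \<Rightarrow> bool" where
  "trading_transform n k A B \<longleftrightarrow>
     (\<forall>j\<in>{1..k}. A j \<subseteq> {1..n} \<and> B j \<subseteq> {1..n}) \<and>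
     (\<forall>i\<in>{1..n}. card {j\<in>{1..k}. i \<in> A j} = card {j\<in>{1..k}. i \<in> B j})"

definition CC_star :: "nat \<Rightarrow> nat \<Rightarrow> nat set set \<Rightarrow> bool" where
  "CC_star n k \<Delta> \<longleftrightarrow>
     \<not> (\<exists>A B. trading_transform n k A B \<and> (\<forall>j\<in>{1..k}. A j \<in> \<Delta> \<and> B j \<notin> \<Delta>))"

end

theory Submission
  imports Defs
begin

text \<open>
  If \<open>A\<^sub>j\<close> lies in an initial segment and \<open>B\<^sub>j\<close> does not, then \<open>A\<^sub>j \<prec> B\<^sub>j\<close>. In a trading transform of
  length three, every element has at most one surplus \<open>i\<close> (in \<open>A\<^sub>i - B\<^sub>i\<close>) and at most one deficit
  \<open>j\<close> (in \<open>B\<^sub>j - A\<^sub>j\<close>). Let \<open>P\<^sub>i\<^sub>j\<close> be the set of the elements with surplus \<open>i\<close> and deficit \<open>j\<close>. Cancelling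
  \<open>A\<^sub>i \<inter> B\<^sub>i\<close> and adding \<open>P\<^sub>2\<^sub>3\<close>, \<open>P\<^sub>3\<^sub>1\<close>, \<open>P\<^sub>1\<^sub>2\<close> respectively turns the three comparisons into
  \<open>P\<^sub>1\<^sub>2 \<union> P\<^sub>1\<^sub>3 \<union> P\<^sub>2\<^sub>3 \<prec> P\<^sub>2\<^sub>1 \<union> P\<^sub>3\<^sub>1 \<union> P\<^sub>2\<^sub>3 \<prec> P\<^sub>1\<^sub>2 \<union> P\<^sub>3\<^sub>2 \<union> P\<^sub>3\<^sub>1 \<prec> P\<^sub>1\<^sub>3 \<union> P\<^sub>2\<^sub>3 \<union> P\<^sub>1\<^sub>2\<close>, a cycle. Shorter transforms
  are padded with empty sets, which is harmless since one strict comparison suffices.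
\<close>

lemma qualitative_probability_order_trans:
  assumes "qualitative_probability_order n r" "(X, Y) \<in> r" "(Y, Z) \<in> r"
  shows "(X, Z) \<in> r"
  using assms unfolding qualitative_probability_order_def preorder_on_def by (meson transD)

lemma qualitative_probability_order_total:
  assumes "qualitative_probability_order n r" "X \<subseteq> {1..n}" "Y \<subseteq> {1..n}"
  shows "(X, Y) \<in> r \<or> (Y, X) \<in> r"
proof -
  have "refl_on (Pow {1..n}) r" "total_on (Pow {1..n}) r"
    using assms(1) unfolding qualitative_probability_order_def preorder_on_def by simp_all
  then show ?thesis
    using assms(2,3) by (cases "X = Y") (simp_all add: refl_onD total_on_def)
qed

lemma qualitative_probability_order_refl:
  assumes "qualitative_probability_order n r" "X \<subseteq> {1..n}"
  shows "(X, X) \<in> r"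
  using qualitative_probability_order_total [OF assms assms(2)] by blast

lemma qualitative_probability_order_Un:
  assumes "qualitative_probability_order n r" "X \<subseteq> {1..n}" "Y \<subseteq> {1..n}" "Z \<subseteq> {1..n}"
    and "(X \<union> Y) \<inter> Z = {}"
  shows "(X, Y) \<in> r \<longleftrightarrow> (X \<union> Z, Y \<union> Z) \<in> r"
proof -
  have "\<forall>A B C. A \<subseteq> {1..n} \<and> B \<subseteq> {1..n} \<and> C \<subseteq> {1..n} \<and> (A \<union> B) \<inter> C = {} \<longrightarrow>
      ((A, B) \<in> r \<longleftrightarrow> (A \<union> C, B \<union> C) \<in> r)"
    using assms(1) unfolding qualitative_probability_order_def by (elim conjE)
  from this [rule_format, of X Y Z] assms(2-5) show ?thesis
    by (simp only: simp_thms)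
qed

lemma qualitative_probability_order_Diff:
  assumes "qualitative_probability_order n r" "X \<subseteq> {1..n}" "Y \<subseteq> {1..n}"
  shows "(X, Y) \<in> r \<longleftrightarrow> (X - Y, Y - X) \<in> r"
proof -
  have "(X - Y, Y - X) \<in> r \<longleftrightarrow> (X - Y \<union> X \<inter> Y, Y - X \<union> X \<inter> Y) \<in> r"
    using assms(2,3) by (intro qualitative_probability_order_Un [OF assms(1)]) auto
  moreover have "X - Y \<union> X \<inter> Y = X" "Y - X \<union> X \<inter> Y = Y"
    by auto
  ultimately show ?thesis
    by simp
qed

text \<open>Common elements cancel, so both comparisons reduce to the same pair of differences;
  cancelling and adding thus become one step.\<close>

lemma qualitative_probability_order_cong_Diff:
  assumes "qualitative_probability_order n r"
    and "X \<subseteq> {1..n}" "Y \<subseteq> {1..n}" "X' \<subseteq> {1..n}" "Y' \<subseteq> {1..n}"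
    and "X - Y = X' - Y'" "Y - X = Y' - X'"
  shows "(X, Y) \<in> r \<longleftrightarrow> (X', Y') \<in> r"
  using qualitative_probability_order_Diff [OF assms(1-3)]
    qualitative_probability_order_Diff [OF assms(1,4,5)] assms(6,7) by simp

lemma no_trading_transform_of_three:
  assumes r: "qualitative_probability_order n r"
    and sub: "A1 \<subseteq> {1..n}" "A2 \<subseteq> {1..n}" "A3 \<subseteq> {1..n}"
      "B1 \<subseteq> {1..n}" "B2 \<subseteq> {1..n}" "B3 \<subseteq> {1..n}"
    and bal: "\<And>i. i \<in> {1..n} \<Longrightarrow>
      of_bool (i \<in> A1) + of_bool (i \<in> A2) + of_bool (i \<in> A3) =
      (of_bool (i \<in> B1) + of_bool (i \<in> B2) + of_bool (i \<in> B3) :: nat)"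
    and le: "(A2, B2) \<in> r" "(A3, B3) \<in> r"
    and less: "strict_part r A1 B1"
  shows False
proof -
  define P where "P A B A' B' = (A - B) \<inter> (B' - A')" for A B A' B' :: "nat set"
  \<comment> \<open>\<open>X\<close>, \<open>Y\<close>, \<open>Z\<close> are the left sides of the
    three comparisons; balance makes them the right sides too.\<close>
  define X where "X = (A1 - B1) \<union> P A2 B2 A3 B3"
  define Y where "Y = (A2 - B2) \<union> P A3 B3 A1 B1"
  define Z where "Z = (A3 - B3) \<union> P A1 B1 A2 B2"
  have bal': "of_bool (i \<in> A1) + of_bool (i \<in> A2) + of_bool (i \<in> A3) =
      (of_bool (i \<in> B1) + of_bool (i \<in> B2) + of_bool (i \<in> B3) :: nat)" for i
    using bal sub by (cases "i \<in> {1..n}") (auto simp: subset_iff)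
  have XYZ: "X \<subseteq> {1..n}" "Y \<subseteq> {1..n}" "Z \<subseteq> {1..n}"
    using sub unfolding X_def Y_def Z_def P_def by auto
  \<comment> \<open>Balance pairs each surplus with one deficit. For instance, deficit 1 forces
    surplus 2 or 3, hence membership in \<open>Y\<close> but not in \<open>X\<close>.\<close>
  have iff: "i \<in> A1 - B1 \<longleftrightarrow> i \<in> X - Y" "i \<in> B1 - A1 \<longleftrightarrow> i \<in> Y - X"
    "i \<in> A2 - B2 \<longleftrightarrow> i \<in> Y - Z" "i \<in> B2 - A2 \<longleftrightarrow> i \<in> Z - Y"
    "i \<in> A3 - B3 \<longleftrightarrow> i \<in> Z - X" "i \<in> B3 - A3 \<longleftrightarrow> i \<in> X - Z" for i
    using bal' [of i] unfolding X_def Y_def Z_def P_def of_bool_def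
    by (simp_all split: if_splits)
  note eq = iff [THEN set_eqI]
  note cong = qualitative_probability_order_cong_Diff [OF r]
  have "(Y, Z) \<in> r"
    using cong [OF sub(2,5) XYZ(2,3) eq(3,4)] le by simp
  moreover have "(Z, X) \<in> r"
    using cong [OF sub(3,6) XYZ(3,1) eq(5,6)] le by simp
  moreover have "(Y, X) \<notin> r"
    using cong [OF sub(4,1) XYZ(2,1) eq(2,1)] less by (simp add: strict_part_def)
  ultimately show False
    using qualitative_probability_order_trans [OF r] by blast
qed

text \<open>By totality, \<open>Y\<close> outside the segment gives \<open>T \<preceq> Y\<close>, so
  \<open>X \<prec> T \<preceq> Y\<close>.\<close>

lemma strict_part_initial_segment:
  assumes r: "qualitative_probability_order n r" and "T \<subseteq> {1..n}"
    and "X \<in> initial_segment n r T" and "Y \<subseteq> {1..n}" "Y \<notin> initial_segment n r T"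
  shows "strict_part r X Y"
proof -
  have "(T, Y) \<in> r"
    using assms qualitative_probability_order_total [OF r, of T Y]
    unfolding initial_segment_def strict_part_def by blast
  then show ?thesis
    using assms(3) qualitative_probability_order_trans [OF r]
    unfolding initial_segment_def strict_part_def by blast
qed

theorem theorem3:
  fixes n :: nat and \<Delta> :: "nat set set"
  assumes "n \<ge> 1"
    and "initial_segment_complex n \<Delta>"
  shows "\<forall>k. 1 \<le> k \<and> k \<le> 3 \<longrightarrow> CC_star n k \<Delta>"
proof (intro allI impI)
  fix k :: nat
  assume k: "1 \<le> k \<and> k \<le> 3"
  obtain r T where r: "qualitative_probability_order n r" and T: "T \<subseteq> {1..n}"
    and \<Delta>: "\<Delta> = initial_segment n r T"
    using assms(2) unfolding initial_segment_complex_def by blast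
  show "CC_star n k \<Delta>"
    unfolding CC_star_def
  proof (intro notI, elim exE conjE)
    fix A B
    assume tt: "trading_transform n k A B" and AB: "\<forall>j\<in>{1..k}. A j \<in> \<Delta> \<and> B j \<notin> \<Delta>"
    define A' where "A' j = (if j \<le> k then A j else {})" for j
    define B' where "B' j = (if j \<le> k then B j else {})" for j
    have sub: "A' j \<subseteq> {1..n}" "B' j \<subseteq> {1..n}" if "1 \<le> j" for j
      using tt that unfolding trading_transform_def A'_def B'_def by auto
    have less: "strict_part r (A j) (B j)" if "1 \<le> j" "j \<le> k" for j
      using strict_part_initial_segment [OF r T, of "A j" "B j"] tt AB that
      unfolding trading_transform_def \<Delta> by simp
    have le: "(A' j, B' j) \<in> r" if "1 \<le> j" for j
      using less [of j] that qualitative_probability_order_refl [OF r, of "{}"]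
      unfolding A'_def B'_def strict_part_def by auto
    have bal: "of_bool (i \<in> A' 1) + of_bool (i \<in> A' 2) + of_bool (i \<in> A' 3) =
        (of_bool (i \<in> B' 1) + of_bool (i \<in> B' 2) + of_bool (i \<in> B' 3) :: nat)"
      if "i \<in> {1..n}" for i
    proof -
      \<comment> \<open>Sums of indicators, unlike cardinalities, expand termwise for each
        \<open>k\<close>.\<close>
      have "(\<Sum>j\<in>{1..k}. of_bool (i \<in> A j)) = (\<Sum>j\<in>{1..k}. of_bool (i \<in> B j) :: nat)"
        using tt that unfolding trading_transform_def
        by (simp add: Int_def)
      moreover have "k = 1 \<or> k = 2 \<or> k = 3"
        using k by auto
      ultimately show ?thesis
        unfolding A'_def B'_def by (elim disjE) (simp_all add: numeral_2_eq_2 numeral_3_eq_3 del: sum_of_bool_eq)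
    qed
    \<comment> \<open>Index 1 is never padded, since \<open>1 \<le> k\<close>.\<close>
    have "strict_part r (A' 1) (B' 1)"
      using less [of 1] k by (simp add: A'_def B'_def)
    from no_trading_transform_of_three [OF r sub(1,1,1) sub(2,2,2) bal le le this]
    show False
      by simp
  qed
qed

end
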